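(* Let $n\ge 1$ and $d\ge 3$, and let $f,g\in\mathbb{C}[x_0,\dots,x_n]$ be two homogeneous polynomials of degree $d$. If $J_f=J_g$, $V(f)\neq V(g)$ (i.e. $f\notin\mathbb{C}^*g$), and $V(f)$ is smooth, then $f$ is of Sebastiani-Thom type.
   Context: Work over $\mathbb{C}$; $S=\mathbb{C}[x_0,\dots,x_n]$ with its standard grading. A homogeneous polynomial of degree $d$ is understood to be nonzero. For a homogeneous polynomial $f\in S$, $J_f$ is the Jacobian ideal, i.e. the homogeneous ideal of $S$ generated by the first order partial derivatives $f_i=\partial f/\partial x_i$, $i=0,\dots,n$. $V(f)\subset\mathbb{P}^n$ is the projective hypersurface $f=0$, taken with its scheme structure (so $V(f)\ne V(g)$ means precisely $f\notin\mathbb{C}^*g$); $V(f)$ is smooth if the $f_i$ have no common zero in $\mathbb{P}^n$. A homogeneous polynomial $f$ of degree $d$ is of Sebastiani-Thom type (ST type) if, for some choice of homogeneous (linear) coordinates $(x_0,\dots,x_n)$ of $\mathbb{P}^n$, some $0\le l\le n-1$, and some forms $g,h$, each either zero or homogeneous of degree $d$, one has $f(x_0,\dots,x_n)=g(x_0,\dots,x_l)+h(x_{l+1},\dots,x_n)$. The case $h=0$ is allowed (then $f$ is called a cone). *)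

theory Defs
  imports Complex_Main "HOL-Library.Poly_Mapping" "HOL-Algebra.Ideal"
begin

text \<open>
  Polynomials over \<open>\<complex>\<close> in variables indexed by natural numbers: finitely supported maps from
  monomials (exponent vectors) to coefficients. The ring structure on this type is the
  convolution product of \<^theory>\<open>HOL-Library.Poly_Mapping\<close>. The type has infinitely many
  variables; \<open>\<complex>[x\<^sub>0, \<dots>, x\<^sub>n]\<close> is the subset \<open>polys {0..n}\<close>.
\<close>

type_synonym monomial = "nat \<Rightarrow>\<^sub>0 nat"
type_synonym cpoly = "monomial \<Rightarrow>\<^sub>0 complex"

definition polys :: "nat set \<Rightarrow> cpoly set" where
  "polys X = {p. \<forall>m \<in> Poly_Mapping.keys p. Poly_Mapping.keys m \<subseteq> X}"

definition poly_ring :: "nat \<Rightarrow> cpoly ring" where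
  "poly_ring n = \<lparr>carrier = polys {0..n}, monoid.mult = (*), one = 1, zero = 0, add = (+)\<rparr>"

definition const_poly :: "complex \<Rightarrow> cpoly" where
  "const_poly c = Poly_Mapping.single 0 c"

definition mdeg :: "monomial \<Rightarrow> nat" where
  "mdeg m = (\<Sum>i \<in> Poly_Mapping.keys m. Poly_Mapping.lookup m i)"

text \<open>By convention, a homogeneous polynomial of degree \<open>d\<close> is nonzero.\<close>

definition homogeneous :: "nat \<Rightarrow> cpoly \<Rightarrow> bool" where
  "homogeneous d p \<longleftrightarrow> p \<noteq> 0 \<and> (\<forall>m \<in> Poly_Mapping.keys p. mdeg m = d)"

text \<open>
  Where \<open>x\<^sub>i\<close> does not occur in \<open>m\<close> the subtraction of exponents truncates, but the
  coefficient is then \<open>0\<close>.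
\<close>

definition partial_deriv :: "nat \<Rightarrow> cpoly \<Rightarrow> cpoly" where
  "partial_deriv i p = (\<Sum>m \<in> Poly_Mapping.keys p.
     Poly_Mapping.single (m - Poly_Mapping.single i 1)
       (of_nat (Poly_Mapping.lookup m i) * Poly_Mapping.lookup p m))"

definition eval_poly :: "(nat \<Rightarrow> complex) \<Rightarrow> cpoly \<Rightarrow> complex" where
  "eval_poly a p = (\<Sum>m \<in> Poly_Mapping.keys p.
     Poly_Mapping.lookup p m * (\<Prod>i \<in> Poly_Mapping.keys m. a i ^ Poly_Mapping.lookup m i))"

definition subst_poly :: "(nat \<Rightarrow> cpoly) \<Rightarrow> cpoly \<Rightarrow> cpoly" where
  "subst_poly L p = (\<Sum>m \<in> Poly_Mapping.keys p.
     const_poly (Poly_Mapping.lookup p m) *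
       (\<Prod>i \<in> Poly_Mapping.keys m. L i ^ Poly_Mapping.lookup m i))"

definition jacobian_ideal :: "nat \<Rightarrow> cpoly \<Rightarrow> cpoly set" where
  "jacobian_ideal n f = genideal (poly_ring n) ((\<lambda>i. partial_deriv i f) ` {0..n})"

text \<open>
  A point of \<open>\<PP>\<^sup>n\<close> is given by homogeneous coordinates \<open>a 0, \<dots>, a n\<close>, not all zero;
  the values of \<open>a\<close> beyond \<open>n\<close> are irrelevant for \<open>f \<in> polys {0..n}\<close>.
\<close>

definition smooth_hypersurface :: "nat \<Rightarrow> cpoly \<Rightarrow> bool" where
  "smooth_hypersurface n f \<longleftrightarrow>
     \<not> (\<exists>a. (\<exists>i \<in> {0..n}. a i \<noteq> 0) \<and> (\<forall>i \<in> {0..n}. eval_poly a (partial_deriv i f) = 0))"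

text \<open>
  A choice of linear coordinates: \<open>n + 1\<close> linearly independent linear forms, hence a basis
  of the space of linear forms in \<open>x\<^sub>0, \<dots>, x\<^sub>n\<close>.
\<close>

definition linear_coordinates :: "nat \<Rightarrow> (nat \<Rightarrow> cpoly) \<Rightarrow> bool" where
  "linear_coordinates n L \<longleftrightarrow>
     (\<forall>i \<in> {0..n}. L i \<in> polys {0..n} \<and> homogeneous 1 (L i)) \<and>
     (\<forall>c. (\<Sum>i = 0..n. const_poly (c i) * L i) = 0 \<longrightarrow> (\<forall>i \<in> {0..n}. c i = 0))"

text \<open>
  The last equation says \<open>f = g(L\<^sub>0, \<dots>, L\<^sub>l) + h(L\<^bsub>l+1\<^esub>, \<dots>, L\<^sub>n)\<close>, i.e. \<open>f\<close> written in the
  coordinates \<open>L\<close>.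
\<close>

definition ST_type :: "nat \<Rightarrow> nat \<Rightarrow> cpoly \<Rightarrow> bool" where
  "ST_type n d f \<longleftrightarrow>
     (\<exists>L l g h. linear_coordinates n L \<and> l + 1 \<le> n \<and>
        g \<in> polys {0..l} \<and> (g = 0 \<or> homogeneous d g) \<and>
        h \<in> polys {l+1..n} \<and> (h = 0 \<or> homogeneous d h) \<and>
        f = subst_poly L g + subst_poly L h)"

lemma polys_add: "p \<in> polys X \<Longrightarrow> q \<in> polys X \<Longrightarrow> p + q \<in> polys X"
  using Poly_Mapping.keys_add[of p q] by (auto simp: polys_def)

lemma polys_uminus: "p \<in> polys X \<Longrightarrow> - p \<in> polys X"
  by (simp add: polys_def)

lemma polys_mult:
  assumes "p \<in> polys X" "q \<in> polys X"
  shows "p * q \<in> polys X"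
proof -
  have "Poly_Mapping.keys m \<subseteq> X" if m: "m \<in> Poly_Mapping.keys (p * q)" for m
  proof -
    obtain a b where "m = a + b" "a \<in> Poly_Mapping.keys p" "b \<in> Poly_Mapping.keys q"
      using m Poly_Mapping.keys_mult[of p q] by blast
    then show ?thesis
      using assms Poly_Mapping.keys_add[of a b] unfolding polys_def by blast
  qed
  then show ?thesis by (simp add: polys_def)
qed

lemma polys_0: "0 \<in> polys X" and polys_1: "1 \<in> polys X"
  by (simp_all add: polys_def)

lemma cring_poly_ring: "cring (poly_ring n)"
proof (rule cringI)
  show "abelian_group (poly_ring n)"
  proof (rule abelian_groupI)
    fix x assume x: "x \<in> carrier (poly_ring n)"
    then show "\<exists>y \<in> carrier (poly_ring n). y \<oplus>\<^bsub>poly_ring n\<^esub> x = \<zero>\<^bsub>poly_ring n\<^esub>"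
      by (intro bexI[of _ "- x"]) (auto simp: poly_ring_def polys_uminus)
  qed (auto simp: poly_ring_def polys_add polys_0 add.assoc add.commute)
  show "comm_monoid (poly_ring n)"
    by (rule comm_monoidI) (auto simp: poly_ring_def polys_mult polys_1 mult.assoc mult.commute)
qed (auto simp: poly_ring_def algebra_simps)

end

theory Submission
  imports "Jordan_Normal_Form.Spectral_Radius" "HOL-Library.Function_Algebras" Defs
begin

text \<open>
  Comparing degrees in \<open>J\<^sub>f = J\<^sub>g\<close> gives a constant matrix \<open>A\<close> with
  \<open>g\<^sub>i = \<Sum>\<^sub>j A\<^sub>i\<^sub>j f\<^sub>j\<close>. Let \<open>z\<close> be an eigenvalue of \<open>A\<close> and let \<open>T\<close> be the transpose of
  \<open>A - z\<close>. With \<open>G = g - z f\<close> one has \<open>D\<^sub>T\<^sub>u f = D\<^sub>u G\<close> for all directions \<open>u\<close>, so that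
  \<open>D\<^sub>v D\<^sub>T\<^sub>u f = D\<^sub>v D\<^sub>u G = D\<^sub>u D\<^sub>T\<^sub>v f\<close>. Hence \<open>D\<^sub>v D\<^sub>w f = 0\<close> for \<open>v \<in> ker T\<close> and \<open>w \<in> im T\<close>.
  A vector \<open>w \<noteq> 0\<close> in \<open>ker T \<inter> im T\<close> would satisfy \<open>D\<^sub>w D\<^sub>w f = 0\<close>, and then, by Euler's
  identity and \<open>d \<ge> 3\<close>, all \<open>f\<^sub>j\<close> would vanish at \<open>w\<close>. So smoothness makes the space the
  direct sum of \<open>ker T\<close> and \<open>im T\<close>, and in adapted coordinates the mixed second derivatives
  of \<open>f\<close> vanish, i.e. \<open>f\<close> splits. The kernel is nonzero by the choice of \<open>z\<close>; if \<open>T = 0\<close>, then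
  \<open>G = 0\<close> by Euler's identity and \<open>f\<close> is a multiple of \<open>g\<close>.
\<close>

section \<open>Derivatives, substitution and forms\<close>

definition var :: "nat \<Rightarrow> cpoly" where
  "var i = Poly_Mapping.single (Poly_Mapping.single i 1) 1"

text \<open>Unlike \<open>homogeneous\<close>, this admits the zero polynomial, so that the forms of
  a fixed degree are closed under sums.\<close>

definition form :: "nat \<Rightarrow> cpoly \<Rightarrow> bool" where
  "form d p \<longleftrightarrow> (\<forall>m \<in> Poly_Mapping.keys p. mdeg m = d)"

definition dir_deriv :: "nat \<Rightarrow> (nat \<Rightarrow> complex) \<Rightarrow> cpoly \<Rightarrow> cpoly" where
  "dir_deriv n u p = (\<Sum>k = 0..n. const_poly (u k) * partial_deriv k p)"

section \<open>Constants, variables and expansion into terms\<close>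

lemma const_poly_0 [simp]: "const_poly 0 = 0"
  and const_poly_1 [simp]: "const_poly 1 = 1"
  by (simp_all add: const_poly_def)

lemma const_poly_add: "const_poly (a + b) = const_poly a + const_poly b"
  and const_poly_diff: "const_poly (a - b) = const_poly a - const_poly b"
  and const_poly_mult: "const_poly (a * b) = const_poly a * const_poly b"
  by (simp_all add: const_poly_def single_add single_diff mult_single)

lemma const_poly_sum: "const_poly (sum c I) = (\<Sum>i\<in>I. const_poly (c i))"
  by (induction I rule: infinite_finite_induct) (simp_all add: const_poly_add)

lemma const_poly_prod: "const_poly (prod c I) = (\<Prod>i\<in>I. const_poly (c i))"
  by (induction I rule: infinite_finite_induct) (simp_all add: const_poly_mult)

lemma const_poly_power: "const_poly (c ^ k) = const_poly c ^ k"
  by (induction k) (simp_all add: const_poly_mult)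

lemma const_poly_eq_iff [simp]: "const_poly a = const_poly b \<longleftrightarrow> a = b"
  by (metis const_poly_def lookup_single_eq)

lemma lookup_const_poly_mult [simp]:
  "Poly_Mapping.lookup (const_poly c * p) m = c * Poly_Mapping.lookup p m"
  by (simp add: const_poly_def mult_map_scale_conv_mult [symmetric] Poly_Mapping.map.rep_eq when_def)

lemma poly_mapping_sum_singles:
  "p = (\<Sum>m \<in> Poly_Mapping.keys p. Poly_Mapping.single m (Poly_Mapping.lookup p m))"
  for p :: "'a \<Rightarrow>\<^sub>0 'b::comm_monoid_add"
proof (rule poly_mapping_eqI)
  fix k
  show "Poly_Mapping.lookup p k = Poly_Mapping.lookup
    (\<Sum>m \<in> Poly_Mapping.keys p. Poly_Mapping.single m (Poly_Mapping.lookup p m)) k"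
    by (simp add: lookup_sum lookup_single when_def in_keys_iff)
qed

text \<open>A polynomial is the sum of its terms; the term with coefficient zero serves as the empty
  sum.\<close>

lemma cpoly_induct_single [case_names single add]:
  fixes p :: cpoly
  assumes "\<And>m c. P (Poly_Mapping.single m c)"
    and "\<And>p q. P p \<Longrightarrow> P q \<Longrightarrow> P (p + q)"
  shows "P p"
proof -
  have "P (\<Sum>m \<in> S. Poly_Mapping.single m (Poly_Mapping.lookup p m))" if "finite S" for S
    using that by (induction S) (use assms(1)[of 0 0] in \<open>simp_all add: assms\<close>)
  then show ?thesis
    using poly_mapping_sum_singles[of p] by (metis finite_keys)
qed

lemma var_power: "var i ^ k = Poly_Mapping.single (Poly_Mapping.single i k) 1"
  by (induction k) (simp_all add: var_def mult_single single_add [symmetric])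

lemma prod_vars:
  "finite I \<Longrightarrow> (\<Prod>i\<in>I. var i ^ e i) = Poly_Mapping.single (\<Sum>i\<in>I. Poly_Mapping.single i (e i)) 1"
  by (induction I rule: finite_induct) (simp_all add: mult_single var_power)

lemma single_conv_vars:
  "Poly_Mapping.single m c = const_poly c * (\<Prod>i \<in> Poly_Mapping.keys m. var i ^ Poly_Mapping.lookup m i)"
  by (simp only: prod_vars finite_keys poly_mapping_sum_singles[of m, symmetric])
     (simp add: const_poly_def mult_single)

text \<open>Constants and variables generate the ring, so an identity that is compatible with sums
  and products need only be checked on them.\<close>

lemma cpoly_induct [case_names const var add mult]:
  fixes p :: cpoly
  assumes "\<And>c. P (const_poly c)" and "\<And>i. P (var i)"
    and "\<And>p q. P p \<Longrightarrow> P q \<Longrightarrow> P (p + q)" and "\<And>p q. P p \<Longrightarrow> P q \<Longrightarrow> P (p * q)"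
  shows "P p"
proof (induction p rule: cpoly_induct_single)
  case (single m c)
  have 1: "P 1"
    using assms(1)[of 1] by simp
  have pow: "P (var i ^ k)" for i k
    by (induction k) (simp_all only: power.simps assms 1)
  have "P (\<Prod>i\<in>I. var i ^ e i)" if "finite I" for I e
    using that by (induction I) (simp_all add: assms 1 pow)
  then show ?case
    by (simp only: single_conv_vars assms finite_keys)
qed (rule assms)

section \<open>Partial derivatives\<close>

lemma lookup_partial_deriv:
  "Poly_Mapping.lookup (partial_deriv i p) m =
     of_nat (Poly_Mapping.lookup m i + 1) * Poly_Mapping.lookup p (m + Poly_Mapping.single i 1)"
proof -
  let ?e = "Poly_Mapping.single i (1::nat)"
  \<comment> \<open>Truncated subtraction is exact on monomials containing \<open>x_i\<close>, and
    all other terms carry the factor zero. So a single term of \<open>p\<close> contributes to the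
    coefficient at \<open>m\<close>.\<close>
  have eq: "m' - ?e = m \<longleftrightarrow> m' = m + ?e" if "Poly_Mapping.lookup m' i \<noteq> 0" for m'
  proof
    assume "m' - ?e = m"
    then show "m' = m + ?e"
      using that by (auto intro!: poly_mapping_eqI simp: lookup_add lookup_minus lookup_single when_def)
  qed simp
  have "Poly_Mapping.lookup (partial_deriv i p) m = (\<Sum>m' \<in> Poly_Mapping.keys p.
      if m' = m + ?e then of_nat (Poly_Mapping.lookup m' i) * Poly_Mapping.lookup p m' else 0)"
    unfolding partial_deriv_def lookup_sum lookup_single when_def
    by (rule sum.cong) (use eq in auto)
  then show ?thesis
    by (simp add: in_keys_iff lookup_add)
qed

lemma partial_deriv_add: "partial_deriv i (p + q) = partial_deriv i p + partial_deriv i q"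
  by (rule poly_mapping_eqI) (simp add: lookup_partial_deriv lookup_add algebra_simps)

lemma partial_deriv_diff: "partial_deriv i (p - q) = partial_deriv i p - partial_deriv i q"
  by (rule poly_mapping_eqI) (simp add: lookup_partial_deriv lookup_minus algebra_simps)

lemma partial_deriv_0 [simp]: "partial_deriv i 0 = 0"
  by (simp add: partial_deriv_def)

lemma partial_deriv_sum: "partial_deriv i (sum p I) = (\<Sum>j\<in>I. partial_deriv i (p j))"
  by (induction I rule: infinite_finite_induct) (simp_all add: partial_deriv_add)

lemma partial_deriv_const_mult: "partial_deriv i (const_poly c * p) = const_poly c * partial_deriv i p"
  by (rule poly_mapping_eqI) (simp add: lookup_partial_deriv)

lemma partial_deriv_commute: "partial_deriv i (partial_deriv j p) = partial_deriv j (partial_deriv i p)"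
  by (rule poly_mapping_eqI)
     (simp add: lookup_partial_deriv lookup_add lookup_single when_def ac_simps)

lemma partial_deriv_single:
  "partial_deriv i (Poly_Mapping.single m c) =
     Poly_Mapping.single (m - Poly_Mapping.single i 1) (of_nat (Poly_Mapping.lookup m i) * c)"
  by (simp add: partial_deriv_def)

lemma partial_deriv_const [simp]: "partial_deriv i (const_poly c) = 0"
  by (simp add: const_poly_def partial_deriv_single)

lemma partial_deriv_var: "partial_deriv i (var j) = (if i = j then 1 else 0)"
  by (simp add: var_def partial_deriv_single lookup_single)

text \<open>Both sides are bilinear, so two single terms suffice. There the exponents of
  \<open>x_i\<close> add up; where one of them is zero, the summand with the truncated subtraction
  vanishes.\<close>

lemma partial_deriv_mult: "partial_deriv i (p * q) = partial_deriv i p * q + p * partial_deriv i q"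
proof (induction p rule: cpoly_induct_single)
  case (single a c)
  show ?case
  proof (induction q rule: cpoly_induct_single)
    case (single b c')
    let ?e = "Poly_Mapping.single i (1::nat)"
    have 1: "a - ?e + b = a + b - ?e" if "Poly_Mapping.lookup a i \<noteq> 0"
      using that by (auto intro!: poly_mapping_eqI simp: lookup_add lookup_minus lookup_single when_def)
    have 2: "a + (b - ?e) = a + b - ?e" if "Poly_Mapping.lookup b i \<noteq> 0"
      using that by (auto intro!: poly_mapping_eqI simp: lookup_add lookup_minus lookup_single when_def)
    show ?case
      using 1 2
      by (cases "Poly_Mapping.lookup a i = 0"; cases "Poly_Mapping.lookup b i = 0")
         (simp_all add: partial_deriv_single mult_single lookup_add single_add [symmetric] algebra_simps)
  qed (simp add: partial_deriv_add algebra_simps)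
qed (simp add: partial_deriv_add algebra_simps)

section \<open>Directional derivatives\<close>

lemma dir_deriv_0 [simp]: "dir_deriv n u 0 = 0"
  by (simp add: dir_deriv_def)

lemma dir_deriv_add: "dir_deriv n u (p + q) = dir_deriv n u p + dir_deriv n u q"
  by (simp add: dir_deriv_def partial_deriv_add algebra_simps sum.distrib)

lemma dir_deriv_mult: "dir_deriv n u (p * q) = dir_deriv n u p * q + p * dir_deriv n u q"
  by (simp add: dir_deriv_def partial_deriv_mult algebra_simps sum.distrib sum_distrib_left)

lemma partial_deriv_dir_deriv: "partial_deriv i (dir_deriv n u p) = dir_deriv n u (partial_deriv i p)"
  by (simp add: dir_deriv_def partial_deriv_sum partial_deriv_const_mult partial_deriv_commute[of i])

lemma dir_deriv_commute: "dir_deriv n u (dir_deriv n v p) = dir_deriv n v (dir_deriv n u p)"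
proof -
  have "dir_deriv n u (dir_deriv n v p) =
      (\<Sum>k = 0..n. \<Sum>j = 0..n. const_poly (u k) * (const_poly (v j) * partial_deriv j (partial_deriv k p)))"
    unfolding dir_deriv_def[of n u] partial_deriv_dir_deriv by (simp add: dir_deriv_def sum_distrib_left)
  also have "\<dots> = (\<Sum>j = 0..n. \<Sum>k = 0..n. const_poly (v j) * (const_poly (u k) * partial_deriv k (partial_deriv j p)))"
    by (subst sum.swap) (simp add: partial_deriv_commute mult.left_commute)
  also have "\<dots> = dir_deriv n v (dir_deriv n u p)"
    unfolding dir_deriv_def[of n v] partial_deriv_dir_deriv by (simp add: dir_deriv_def sum_distrib_left)
  finally show ?thesis .
qed

section \<open>Substitution as a ring homomorphism\<close>

lemma subst_poly_superset:
  assumes "finite S" "Poly_Mapping.keys p \<subseteq> S"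
  shows "subst_poly L p = (\<Sum>m \<in> S. const_poly (Poly_Mapping.lookup p m) *
           (\<Prod>i \<in> Poly_Mapping.keys m. L i ^ Poly_Mapping.lookup m i))"
  unfolding subst_poly_def using assms
  by (intro sum.mono_neutral_left) (auto simp: in_keys_iff)

lemma subst_poly_add: "subst_poly L (p + q) = subst_poly L p + subst_poly L q"
proof -
  let ?S = "Poly_Mapping.keys p \<union> Poly_Mapping.keys q"
  have "Poly_Mapping.keys (p + q) \<subseteq> ?S"
    by (rule Poly_Mapping.keys_add)
  then show ?thesis
    by (simp add: subst_poly_superset[of ?S] lookup_add const_poly_add distrib_right sum.distrib)
qed

lemma subst_poly_single:
  "subst_poly L (Poly_Mapping.single m c) =
     const_poly c * (\<Prod>i \<in> Poly_Mapping.keys m. L i ^ Poly_Mapping.lookup m i)"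
  by (simp add: subst_poly_def)

lemma prod_powers_superset:
  fixes L :: "nat \<Rightarrow> 'a::comm_monoid_mult" and m :: monomial
  assumes "finite S" "Poly_Mapping.keys m \<subseteq> S"
  shows "(\<Prod>i \<in> Poly_Mapping.keys m. L i ^ Poly_Mapping.lookup m i) = (\<Prod>i \<in> S. L i ^ Poly_Mapping.lookup m i)"
  using assms by (intro prod.mono_neutral_left) (auto simp: in_keys_iff)

lemma subst_poly_mult: "subst_poly L (p * q) = subst_poly L p * subst_poly L q"
proof (induction p rule: cpoly_induct_single)
  case (single a c)
  show ?case
  proof (induction q rule: cpoly_induct_single)
    case (single b c')
    let ?S = "Poly_Mapping.keys a \<union> Poly_Mapping.keys b"
    have "Poly_Mapping.keys (a + b) \<subseteq> ?S"
      by (rule Poly_Mapping.keys_add)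
    then show ?case
      by (simp only: mult_single subst_poly_single prod_powers_superset[of ?S] finite_Un finite_keys
            Un_upper1 Un_upper2)
         (simp add: lookup_add power_add prod.distrib const_poly_mult ac_simps)
  qed (simp add: subst_poly_add distrib_left)
qed (simp add: subst_poly_add distrib_right)

lemma subst_poly_0 [simp]: "subst_poly L 0 = 0"
  by (simp add: subst_poly_def)

lemma subst_poly_const [simp]: "subst_poly L (const_poly c) = const_poly c"
  by (simp add: const_poly_def subst_poly_single)

lemma subst_poly_var [simp]: "subst_poly L (var i) = L i"
  by (simp add: var_def subst_poly_single)

lemma subst_poly_sum: "subst_poly L (sum p I) = (\<Sum>i\<in>I. subst_poly L (p i))"
  by (induction I rule: infinite_finite_induct) (simp_all add: subst_poly_add)

lemma subst_poly_subst: "subst_poly L (subst_poly M p) = subst_poly (\<lambda>k. subst_poly L (M k)) p"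
  by (induction p rule: cpoly_induct) (simp_all add: subst_poly_add subst_poly_mult)

lemma subst_poly_var_id: "subst_poly var p = p"
  by (induction p rule: cpoly_induct) (simp_all add: subst_poly_add subst_poly_mult)

lemma subst_poly_cong:
  assumes "p \<in> polys X" "\<And>i. i \<in> X \<Longrightarrow> L i = M i"
  shows "subst_poly L p = subst_poly M p"
proof -
  have "L i = M i" if "m \<in> Poly_Mapping.keys p" "i \<in> Poly_Mapping.keys m" for m i
    using assms that by (auto simp: polys_def)
  then show ?thesis
    unfolding subst_poly_def by simp
qed

text \<open>This is the chain rule for inner functions with constant derivatives \<open>u k\<close>.
  Sending the variables beyond \<open>n\<close> to zero matches the fact that
  \<open>dir_deriv\<close> does not differentiate by them.\<close>

lemma partial_deriv_subst_poly:
  assumes "\<And>k. k \<le> n \<Longrightarrow> partial_deriv i (L k) = const_poly (u k)"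
    and "\<And>k. k > n \<Longrightarrow> L k = 0"
  shows "partial_deriv i (subst_poly L p) = subst_poly L (dir_deriv n u p)"
proof (induction p rule: cpoly_induct)
  case (var k)
  have "dir_deriv n u (var k) = (if k \<le> n then const_poly (u k) else 0)"
    by (simp add: dir_deriv_def partial_deriv_var if_distrib cong: if_cong)
  then show ?case
    using assms by simp
qed (simp_all add: dir_deriv_add dir_deriv_mult partial_deriv_add partial_deriv_mult subst_poly_add
       subst_poly_mult, simp add: dir_deriv_def)

text \<open>Evaluation becomes a substitution of constants, so it inherits the homomorphism
  laws.\<close>

lemma const_poly_eval: "const_poly (eval_poly a p) = subst_poly (\<lambda>i. const_poly (a i)) p"
  by (simp add: eval_poly_def subst_poly_def const_poly_sum const_poly_mult const_poly_prod const_poly_power)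

lemma polys_const: "const_poly c \<in> polys X"
  by (auto simp: const_poly_def polys_def)

lemma polys_var: "i \<in> X \<Longrightarrow> var i \<in> polys X"
  by (auto simp: var_def polys_def)

lemma polys_diff: "p \<in> polys X \<Longrightarrow> q \<in> polys X \<Longrightarrow> p - q \<in> polys X"
  using polys_add[OF _ polys_uminus, of p X q] by simp

lemma polys_sum: "(\<And>i. i \<in> I \<Longrightarrow> p i \<in> polys X) \<Longrightarrow> sum p I \<in> polys X"
  by (induction I rule: infinite_finite_induct) (simp_all add: polys_0 polys_add)

lemma polys_subst_poly: "(\<And>i. L i \<in> polys X) \<Longrightarrow> subst_poly L p \<in> polys X"
  by (induction p rule: cpoly_induct) (simp_all add: subst_poly_add subst_poly_mult polys_const polys_add polys_mult)

section \<open>Degrees and forms\<close>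

lemma mdeg_superset:
  assumes "finite S" "Poly_Mapping.keys m \<subseteq> S"
  shows "mdeg m = (\<Sum>i\<in>S. Poly_Mapping.lookup m i)"
  unfolding mdeg_def using assms by (intro sum.mono_neutral_left) (auto simp: in_keys_iff)

lemma mdeg_add: "mdeg (a + b) = mdeg a + mdeg b"
proof -
  let ?S = "Poly_Mapping.keys a \<union> Poly_Mapping.keys b"
  have "Poly_Mapping.keys (a + b) \<subseteq> ?S"
    by (rule Poly_Mapping.keys_add)
  then show ?thesis
    by (simp add: mdeg_superset[of ?S] lookup_add sum.distrib)
qed

lemma mdeg_single [simp]: "mdeg (Poly_Mapping.single i k) = k"
  by (cases "k = 0") (simp_all add: mdeg_def)

lemma mdeg_eq_0_iff: "mdeg m = 0 \<longleftrightarrow> m = 0"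
  by (auto simp: mdeg_def in_keys_iff intro: poly_mapping_eqI)

lemma form_0 [simp]: "form d 0"
  by (simp add: form_def)

lemma form_add: "form d p \<Longrightarrow> form d q \<Longrightarrow> form d (p + q)"
  using Poly_Mapping.keys_add[of p q] by (auto simp: form_def)

lemma form_diff: "form d p \<Longrightarrow> form d q \<Longrightarrow> form d (p - q)"
  using keys_diff[of p q] by (auto simp: form_def)

lemma form_sum: "(\<And>i. i \<in> I \<Longrightarrow> form d (p i)) \<Longrightarrow> form d (sum p I)"
  by (induction I rule: infinite_finite_induct) (simp_all add: form_add)

lemma form_mult: "form d p \<Longrightarrow> form e q \<Longrightarrow> form (d + e) (p * q)"
  using Poly_Mapping.keys_mult[of p q] by (force simp: form_def mdeg_add)

lemma form_const [simp]: "form 0 (const_poly c)"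
  by (simp add: form_def const_poly_def mdeg_eq_0_iff)

lemma form_const_mult: "form d p \<Longrightarrow> form d (const_poly c * p)"
  using form_mult[of 0 "const_poly c" d p] by simp

lemma form_var: "form 1 (var i)"
  by (simp add: var_def form_def)

lemma form_1: "form 0 1"
  using form_const[of 1] by simp

lemma form_prod_powers:
  assumes "\<And>i. form 1 (L i)"
  shows "form (\<Sum>i\<in>I. e i) (\<Prod>i\<in>I. L i ^ e i)"
proof -
  have "form k (L i ^ k)" for i k
  proof (induction k)
    case (Suc k)
    then show ?case
      using form_mult[OF assms[of i] Suc.IH] by simp
  qed (simp add: form_1)
  then show ?thesis
    by (induction I rule: infinite_finite_induct) (simp_all add: form_mult form_1)
qed

lemma form_subst_poly:
  assumes "form d p" "\<And>i. form 1 (L i)"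
  shows "form d (subst_poly L p)"
  unfolding subst_poly_def
proof (intro form_sum form_const_mult)
  fix m
  assume "m \<in> Poly_Mapping.keys p"
  then have "d = (\<Sum>i \<in> Poly_Mapping.keys m. Poly_Mapping.lookup m i)"
    using assms(1) by (simp add: form_def mdeg_def)
  then show "form d (\<Prod>i \<in> Poly_Mapping.keys m. L i ^ Poly_Mapping.lookup m i)"
    by (simp only: form_prod_powers assms(2))
qed

lemma form_partial_deriv:
  assumes "form d p"
  shows "form (d - 1) (partial_deriv i p)"
  unfolding form_def
proof
  fix m
  assume "m \<in> Poly_Mapping.keys (partial_deriv i p)"
  then have "m + Poly_Mapping.single i 1 \<in> Poly_Mapping.keys p"
    by (simp add: in_keys_iff lookup_partial_deriv)
  then have "mdeg (m + Poly_Mapping.single i 1) = d"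
    using assms by (simp add: form_def)
  then show "mdeg m = d - 1"
    by (simp add: mdeg_add)
qed

lemma form_dir_deriv: "form d p \<Longrightarrow> form (d - 1) (dir_deriv n u p)"
  unfolding dir_deriv_def by (intro form_sum form_const_mult form_partial_deriv)

lemma polys_partial_deriv:
  assumes "p \<in> polys X"
  shows "partial_deriv i p \<in> polys X"
  unfolding polys_def
proof (clarsimp)
  fix m x
  assume "m \<in> Poly_Mapping.keys (partial_deriv i p)" "x \<in> Poly_Mapping.keys m"
  then have "m + Poly_Mapping.single i 1 \<in> Poly_Mapping.keys p"
      and "x \<in> Poly_Mapping.keys (m + Poly_Mapping.single i 1)"
    by (auto simp: in_keys_iff lookup_partial_deriv lookup_add)
  then show "x \<in> X"
    using assms by (auto simp: polys_def)
qed

lemma polys_dir_deriv: "p \<in> polys X \<Longrightarrow> dir_deriv n u p \<in> polys X"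
  unfolding dir_deriv_def by (intro polys_sum polys_mult polys_const polys_partial_deriv)

lemma euler_identity:
  assumes "p \<in> polys {0..n}" "form d p"
  shows "(\<Sum>i = 0..n. var i * partial_deriv i p) = const_poly (of_nat d) * p"
proof -
  \<comment> \<open>The operator \<open>x_i\<close> times the derivative by \<open>x_i\<close>
    multiplies a term by its exponent of \<open>x_i\<close>, and these exponents sum to
    \<open>d\<close>.\<close>
  have *: "(\<Sum>i = 0..n. var i * partial_deriv i (Poly_Mapping.single m c)) = const_poly (of_nat d) * Poly_Mapping.single m c"
    if "m \<in> Poly_Mapping.keys p" for m c
  proof -
    have "var i * partial_deriv i (Poly_Mapping.single m c) =
        const_poly (of_nat (Poly_Mapping.lookup m i)) * Poly_Mapping.single m c" for i
    proof (cases "Poly_Mapping.lookup m i = 0")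
      case False
      then have "Poly_Mapping.single i 1 + (m - Poly_Mapping.single i 1) = m"
        by (auto intro!: poly_mapping_eqI simp: lookup_add lookup_minus lookup_single when_def)
      then show ?thesis
        by (simp add: var_def partial_deriv_single mult_single const_poly_def del: single_of_nat)
    qed (simp add: partial_deriv_single)
    then have "(\<Sum>i = 0..n. var i * partial_deriv i (Poly_Mapping.single m c)) =
        const_poly (of_nat (\<Sum>i = 0..n. Poly_Mapping.lookup m i)) * Poly_Mapping.single m c"
      by (simp add: const_poly_sum sum_distrib_right)
    also have "(\<Sum>i = 0..n. Poly_Mapping.lookup m i) = d"
      using that assms by (subst mdeg_superset[symmetric]) (auto simp: polys_def form_def)
    finally show ?thesis .
  qed
  define c where "c = Poly_Mapping.lookup p"
  have p: "p = (\<Sum>m \<in> Poly_Mapping.keys p. Poly_Mapping.single m (c m))"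
    unfolding c_def by (rule poly_mapping_sum_singles)
  have "(\<Sum>i = 0..n. var i * partial_deriv i p) =
      (\<Sum>i = 0..n. \<Sum>m \<in> Poly_Mapping.keys p. var i * partial_deriv i (Poly_Mapping.single m (c m)))"
    by (subst p) (simp only: partial_deriv_sum sum_distrib_left)
  also have "\<dots> = (\<Sum>m \<in> Poly_Mapping.keys p. const_poly (of_nat d) * Poly_Mapping.single m (c m))"
    by (subst sum.swap) (simp only: * cong: sum.cong)
  also have "\<dots> = const_poly (of_nat d) * p"
    by (subst (2) p) (simp only: sum_distrib_left)
  finally show ?thesis .
qed

text \<open>At the point \<open>w\<close>, the derivative in the direction \<open>w\<close> is the
  left side of Euler's identity.\<close>

lemma eval_dir_deriv_self:
  assumes "p \<in> polys {0..n}" "form d p"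
  shows "eval_poly w (dir_deriv n w p) = of_nat d * eval_poly w p"
proof -
  let ?s = "subst_poly (\<lambda>i. const_poly (w i))"
  have "?s (dir_deriv n w p) = ?s (\<Sum>i = 0..n. var i * partial_deriv i p)"
    by (simp add: dir_deriv_def subst_poly_sum subst_poly_mult)
  also have "\<dots> = const_poly (of_nat d) * ?s p"
    by (simp add: euler_identity[OF assms] subst_poly_mult)
  finally show ?thesis
    by (simp add: const_poly_eval[symmetric] const_poly_mult[symmetric])
qed

text \<open>The point \<open>w\<close> itself would be singular, by Euler's identity along the line through \<open>w\<close>.\<close>

lemma smooth_dir_deriv_twice_nonzero:
  assumes "f \<in> polys {0..n}" "form d f" "d \<ge> 3" "smooth_hypersurface n f"
    and "dir_deriv n w (dir_deriv n w f) = 0" "i \<le> n"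
  shows "w i = 0"
proof (rule ccontr)
  assume "w i \<noteq> 0"
  have "eval_poly w (partial_deriv j f) = 0" for j
  proof -
    let ?p = "partial_deriv j f"
    have p: "?p \<in> polys {0..n}" "form (d - 1) ?p"
      by (rule polys_partial_deriv[OF assms(1)], rule form_partial_deriv[OF assms(2)])
    \<comment> \<open>Euler's identity is used twice, for \<open>?p\<close> and for its derivative
      along \<open>w\<close>. The resulting factor \<open>(d - 1) * (d - 2)\<close> is nonzero
      because \<open>d \<ge> 3\<close>.\<close>
    have "of_nat (d - 1 - 1) * (of_nat (d - 1) * eval_poly w ?p) =
        of_nat (d - 1 - 1) * eval_poly w (dir_deriv n w ?p)"
      by (simp only: eval_dir_deriv_self[OF p])
    also have "\<dots> = eval_poly w (dir_deriv n w (dir_deriv n w ?p))"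
      by (simp only: eval_dir_deriv_self[OF polys_dir_deriv[OF p(1)] form_dir_deriv[OF p(2)]])
    also have "\<dots> = eval_poly w (partial_deriv j 0)"
      by (simp only: partial_deriv_dir_deriv[symmetric] assms(5))
    also have "\<dots> = 0"
      by (simp add: eval_poly_def)
    finally show ?thesis
      using assms(3) by (simp del: of_nat_diff)
  qed
  then show False
    using assms(4,6) \<open>w i \<noteq> 0\<close> unfolding smooth_hypersurface_def by (metis atLeast0AtMost atMost_iff)
qed

section \<open>Kernel and range of an endomorphism\<close>

text \<open>In a vanishing combination the part over \<open>A\<close> is the negative of the part
  over \<open>B\<close>. Both parts then lie in both spans and are zero.\<close>

lemma (in vector_space) independent_Un_span_Int:
  assumes "independent A" "independent B" "finite A" "finite B" "span A \<inter> span B \<subseteq> {0}" "A \<inter> B = {}"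
  shows "independent (A \<union> B)"
proof (rule independent_if_scalars_zero)
  fix u x
  assume sum: "(\<Sum>v\<in>A \<union> B. scale (u v) v) = 0" and x: "x \<in> A \<union> B"
  let ?s = "\<lambda>S. \<Sum>v\<in>S. scale (u v) v"
  have *: "?s A + ?s B = 0"
    using sum assms(3,4,6) by (simp add: sum.union_disjoint)
  have "?s A \<in> span A" "?s B \<in> span B"
    by (rule span_sum, rule span_scale, rule span_base, assumption)+
  moreover have "?s A = - ?s B"
    using * by (simp only: eq_neg_iff_add_eq_0)
  ultimately have "?s A \<in> span A \<inter> span B"
    by (simp add: span_neg)
  then have A: "?s A = 0"
    using assms(5) by auto
  then have B: "?s B = 0"
    using * by simp
  show "u x = 0"
    using x independentD[OF assms(1,3) order.refl A] independentD[OF assms(2,4) order.refl B]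
    by blast
qed (use assms in auto)

text \<open>The coordinates of a common vector with respect to \<open>A \<union> B\<close> are
  supported in \<open>A\<close> and also in \<open>B\<close>, hence nowhere.\<close>

lemma (in vector_space) span_Int_disjoint:
  assumes "independent (A \<union> B)" "A \<inter> B = {}"
  shows "span A \<inter> span B \<subseteq> {0}"
proof
  fix x
  assume x: "x \<in> span A \<inter> span B"
  have "representation (A \<union> B) x b = 0" for b
  proof -
    have "representation (A \<union> B) x = representation A x"
      "representation (A \<union> B) x = representation B x"
      using x assms(1) by (auto intro!: representation_extend)
    then show ?thesis
      using representation_ne_zero[of A x b] representation_ne_zero[of B x b] assms(2) by auto
  qed
  moreover have "(\<Sum>b | representation (A \<union> B) x b \<noteq> 0. scale (representation (A \<union> B) x b) b) = x"
    using x by (intro sum_nonzero_representation_eq assms(1)) (auto intro: span_mono[THEN subsetD])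
  ultimately show "x \<in> {0}"
    by simp
qed

text \<open>The last assumption says that kernel and range of \<open>T\<close> on \<open>V\<close>
  meet only in zero. A basis of the kernel and the image of a complementary basis are then jointly
  independent, and by rank-nullity they are numerous enough to span \<open>V\<close>.\<close>

lemma (in vector_space) kernel_range_basis:
  assumes V: "subspace V" "V \<subseteq> span E" "finite E"
    and T: "Vector_Spaces.linear scale scale T" "T ` V \<subseteq> V"
    and TT: "\<And>v. v \<in> V \<Longrightarrow> T (T v) = 0 \<Longrightarrow> T v = 0"
  obtains K R where "K \<subseteq> V" "\<forall>v\<in>K. T v = 0" "R \<subseteq> T ` V" "K \<inter> R = {}"
    "independent (K \<union> R)" "V \<subseteq> span (K \<union> R)"
proof -
  interpret T: Vector_Spaces.linear scale scale T
    by (fact T)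
  let ?N = "{v \<in> V. T v = 0}"
  have N: "subspace ?N"
    using V(1) by (auto simp: subspace_def T.add T.scale)
  obtain K where K: "K \<subseteq> ?N" "independent K" "?N \<subseteq> span K"
    using maximal_independent_subset by blast
  obtain B where B: "K \<subseteq> B" "B \<subseteq> V" "independent B" "V \<subseteq> span B"
    using maximal_independent_subset_extend[of K V] K by blast
  have finB: "finite B"
    using independent_span_bound[OF V(3) B(3)] B(2) V(2) by auto
  have finK: "finite K"
    using B(1) finB by (rule finite_subset)
  let ?C = "B - K" and ?R = "T ` (B - K)"
  have C: "independent ?C"
    using B(3) by (rule independent_mono) auto
  have CV: "span ?C \<subseteq> V"
    using B(2) V(1) by (intro span_minimal) auto
  \<comment> \<open>Such an \<open>x\<close> lies in the spans of the two disjoint parts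
    \<open>K\<close> and \<open>?C\<close> of the basis \<open>B\<close>.\<close>
  have "x = 0" if "x \<in> span ?C" "T x = 0" for x
  proof -
    have "x \<in> span K \<inter> span ?C"
      using that CV K(3) by auto
    moreover have "K \<union> ?C = B"
      using B(1) by auto
    ultimately show ?thesis
      using span_Int_disjoint[of K ?C] B(3) by auto
  qed
  then have inj: "inj_on T (span ?C)"
    by (simp add: T.inj_on_iff_eq_0)
  then have injC: "inj_on T ?C"
    by (rule inj_on_subset) (rule span_superset)
  have R: "independent ?R"
    using C inj by (rule T.independent_injective_image)
  have spanR: "span ?R \<subseteq> T ` V"
    using CV by (auto simp: T.span_image)
  have int: "span K \<inter> span ?R \<subseteq> {0}"
  proof
    fix x
    assume x: "x \<in> span K \<inter> span ?R"
    then obtain v where v: "v \<in> V" "x = T v"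
      using spanR by auto
    have "span K \<subseteq> ?N"
      using K(1) N by (rule span_minimal)
    then show "x \<in> {0}"
      using TT[of v] v x by blast
  qed
  have disj: "K \<inter> ?R = {}"
  proof -
    have "0 \<notin> K"
      using dependent_zero[of K] K(2) by iprover
    moreover have "K \<inter> ?R \<subseteq> span K \<inter> span ?R"
      by (rule Int_mono; rule span_superset)
    then have "K \<inter> ?R \<subseteq> {0}"
      using int by (rule subset_trans)
    ultimately show ?thesis
      by auto
  qed
  have ind: "independent (K \<union> ?R)"
    using finB by (intro independent_Un_span_Int[OF K(2) R finK _ int disj]) simp
  \<comment> \<open>\<open>K \<union> ?R\<close> has as many elements as \<open>B\<close>; a vector
    of \<open>V\<close> outside its span would extend it to an independent set larger than
    \<open>B\<close>.\<close>
  have "V \<subseteq> span (K \<union> ?R)"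
  proof (rule ccontr)
    assume "\<not> V \<subseteq> span (K \<union> ?R)"
    then obtain v where v: "v \<in> V" "v \<notin> span (K \<union> ?R)"
      by auto
    have "independent (insert v (K \<union> ?R))"
      using v(2) ind by (rule independent_insertI)
    moreover have "insert v (K \<union> ?R) \<subseteq> V"
      using v(1) K(1) T(2) B(2) by auto
    then have "insert v (K \<union> ?R) \<subseteq> span B"
      using B(4) by (rule subset_trans)
    ultimately have "card (insert v (K \<union> ?R)) \<le> card B"
      by (rule independent_span_bound[OF finB, THEN conjunct2])
    moreover have "v \<notin> K \<union> ?R"
      using v(2) span_base[of v "K \<union> ?R"] by metis
    then have "card (insert v (K \<union> ?R)) = Suc (card K + card ?C)"
      using finK finB disj injC by (simp add: card_Un_disjoint card_image)
    moreover have "card K + card ?C = card B"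
      using B(1) finB finK by (simp add: card_Diff_subset card_mono)
    ultimately show False
      by simp
  qed
  then show thesis
    using K(1) B(2) by (intro that[OF _ _ _ disj ind]) auto
qed

text \<open>The rows of \<open>N\<close> are summed over: this is the action of the transpose of \<open>N\<close>.\<close>

definition mat_apply :: "nat \<Rightarrow> (nat \<Rightarrow> nat \<Rightarrow> complex) \<Rightarrow> (nat \<Rightarrow> complex) \<Rightarrow> nat \<Rightarrow> complex" where
  "mat_apply n N u = (\<lambda>j. if j \<le> n then \<Sum>i = 0..n. N i j * u i else 0)"

text \<open>The ambient space is infinite-dimensional. The coordinate space of dimension
  \<open>n + 1\<close> is its subspace \<open>V\<close> of functions vanishing beyond
  \<open>n\<close>, and finiteness comes from the unit vectors spanning it.\<close>

interpretation cfun: vector_space "\<lambda>(c::complex) (v::nat \<Rightarrow> complex) i. c * v i"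
  by unfold_locales (auto simp: algebra_simps fun_eq_iff)

lemma linear_mat_apply:
  "Vector_Spaces.linear (\<lambda>c v i. c * v i) (\<lambda>c v i. c * v i) (mat_apply n N)"
  by unfold_locales
     (auto simp: mat_apply_def fun_eq_iff algebra_simps sum.distrib sum_distrib_left)

text \<open>The adapted basis is numbered as \<open>P 0, ..., P n\<close>, kernel vectors first, and
  the rows of \<open>Q\<close> are its dual basis. The vectors \<open>u\<close> and \<open>v\<close>
  witness that kernel and range are nonzero, so both blocks are nonempty.\<close>

lemma kernel_range_coordinates:
  fixes n :: nat and N :: "nat \<Rightarrow> nat \<Rightarrow> complex"
  defines "V \<equiv> {v. \<forall>i>n. v i = (0::complex)}" and "T \<equiv> mat_apply n N"
  assumes TT: "\<And>v. v \<in> V \<Longrightarrow> T (T v) = 0 \<Longrightarrow> T v = 0"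
    and ker: "u \<in> V" "u \<noteq> 0" "T u = 0" and nz: "v \<in> V" "T v \<noteq> 0"
  obtains P Q :: "nat \<Rightarrow> nat \<Rightarrow> complex" and l where "l < n"
    "\<forall>i\<le>l. P i \<in> V \<and> T (P i) = 0"
    "\<forall>i. l < i \<and> i \<le> n \<longrightarrow> P i \<in> T ` V"
    "\<forall>k\<le>n. \<forall>k'\<le>n. (\<Sum>i = 0..n. P i k * Q i k') = (if k = k' then 1 else 0)"
    "\<forall>i\<le>n. \<forall>i'\<le>n. (\<Sum>k = 0..n. Q i k * P i' k) = (if i = i' then 1 else 0)"
proof -
  interpret T: Vector_Spaces.linear "\<lambda>c v i. c * v i" "\<lambda>c v i. c * v i" T
    unfolding T_def by (rule linear_mat_apply)
  define e where "e k = (\<lambda>i. if i = k then 1 else 0 :: complex)" for k :: nat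
  have sum_apply: "(\<Sum>b\<in>I. F b) i = (\<Sum>b\<in>I. F b i)" for F :: "'b \<Rightarrow> nat \<Rightarrow> complex" and I i
    by (induction I rule: infinite_finite_induct) auto
  have expand: "v = (\<Sum>k = 0..n. (\<lambda>i. v k * e k i))" if "v \<in> V" for v
    using that by (auto simp: V_def fun_eq_iff sum_apply e_def if_distrib not_le cong: if_cong)
  have eV: "e k \<in> V" if "k \<le> n" for k
    using that by (auto simp: V_def e_def)
  have inj_e: "inj_on e {0..n}"
    by (auto simp: inj_on_def e_def fun_eq_iff split: if_splits)
  have V: "cfun.subspace V"
    by (auto simp: cfun.subspace_def V_def)
  have spanE: "V \<subseteq> cfun.span (e ` {0..n})"
  proof
    fix v assume "v \<in> V"
    have "(\<Sum>k = 0..n. (\<lambda>i. v k * e k i)) \<in> cfun.span (e ` {0..n})"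
      by (intro cfun.span_sum cfun.span_scale cfun.span_base) auto
    then show "v \<in> cfun.span (e ` {0..n})"
      using expand[OF \<open>v \<in> V\<close>] by simp
  qed
  have indE: "cfun.independent (e ` {0..n})"
  proof (rule cfun.independent_if_scalars_zero)
    fix c x
    assume 0: "(\<Sum>b\<in>e ` {0..n}. (\<lambda>i. c b * b i)) = 0" and "x \<in> e ` {0..n}"
    then obtain k where k: "k \<le> n" "x = e k"
      by auto
    have "(\<Sum>j = 0..n. c (e j) * e j k) = 0"
      using fun_cong[OF 0, of k] inj_e by (simp add: sum_apply sum.reindex)
    then show "c x = 0"
      using k by (simp add: e_def if_distrib cong: if_cong)
  qed simp
  have TV: "T ` V \<subseteq> V"
    by (auto simp: T_def V_def mat_apply_def)
  obtain K R where KR: "K \<subseteq> V" "\<forall>v\<in>K. T v = 0" "R \<subseteq> T ` V" "K \<inter> R = {}"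
    "cfun.independent (K \<union> R)" "V \<subseteq> cfun.span (K \<union> R)"
    by (rule cfun.kernel_range_basis[OF V spanE finite_imageI[OF finite_atLeastAtMost]
          linear_mat_apply[of n N, folded T_def] TV TT])
  have sub: "K \<union> R \<subseteq> V"
    using KR(1,3) TV by auto
  \<comment> \<open>\<open>K \<union> R\<close> and the unit vectors are both bases of
    \<open>V\<close>, so each bounds the size of the other.\<close>
  have "finite (K \<union> R) \<and> card (K \<union> R) \<le> card (e ` {0..n})"
    by (rule cfun.independent_span_bound[OF _ KR(5) subset_trans[OF sub spanE]]) simp
  then have fin: "finite (K \<union> R)" and "card (K \<union> R) \<le> card (e ` {0..n})"
    by (rule conjunct1, rule conjunct2)
  moreover have "e ` {0..n} \<subseteq> V"
    using eV by auto
  then have "card (e ` {0..n}) \<le> card (K \<union> R)"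
    by (intro cfun.independent_span_bound[OF fin indE, THEN conjunct2] subset_trans[OF _ KR(6)])
  ultimately have card: "card (K \<union> R) = Suc n"
    using card_image[OF inj_e] by simp
  \<comment> \<open>Otherwise \<open>V\<close> is the range and \<open>u = T w\<close> for some
    \<open>w\<close>; then \<open>T (T w) = 0\<close> forces \<open>u = 0\<close>.\<close>
  have "K \<noteq> {}"
  proof
    assume "K = {}"
    have "u \<in> cfun.span R"
      using ker(1) KR(6) \<open>K = {}\<close> by auto
    also have "cfun.span R \<subseteq> T ` V"
      using KR(3) T.subspace_image[OF V] by (rule cfun.span_minimal)
    finally show False
      using ker TT by auto
  qed
  have "R \<noteq> {}"
  proof
    assume "R = {}"
    have "v \<in> cfun.span K"
      using nz(1) KR(6) \<open>R = {}\<close> by auto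
    also have "cfun.span K \<subseteq> {v. T v = 0}"
      by (rule cfun.span_minimal[OF _ T.subspace_kernel]) (use KR(2) in auto)
    finally show False
      using nz by auto
  qed
  obtain xs ys where xs: "set xs = K" "distinct xs" and ys: "set ys = R" "distinct ys"
    using fin finite_distinct_list by (metis finite_Un)
  define P where "P i = (xs @ ys) ! i" for i
  \<comment> \<open>\<open>l\<close> is the index of the last kernel vector; the subtraction is
    exact because \<open>K\<close> is nonempty.\<close>
  define l where "l = length xs - 1"
  have len: "length (xs @ ys) = Suc n" "length xs \<noteq> 0" "length ys \<noteq> 0"
    using card xs ys KR(4) \<open>K \<noteq> {}\<close> \<open>R \<noteq> {}\<close> fin
    by (auto simp: card_Un_disjoint distinct_card[symmetric])
  have bij: "bij_betw P {0..n} (K \<union> R)"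
    using bij_betw_nth[of "xs @ ys" "{0..n}" "K \<union> R"] xs ys KR(4) len(1)
    by (auto simp: P_def[abs_def] lessThan_Suc_atMost atLeast0AtMost)
  have PV: "P i \<in> V" if "i \<le> n" for i
    using bij sub that by (force simp: bij_betw_def)
  have "\<exists>c. (\<Sum>b\<in>K \<union> R. (\<lambda>i. c b * b i)) = e k" if "k \<le> n" for k
  proof -
    have "e k \<in> range (\<lambda>c. \<Sum>b\<in>K \<union> R. (\<lambda>i. c b * b i))"
      using subsetD[OF KR(6) eV[OF that]] by (simp only: cfun.span_finite[OF fin])
    then show ?thesis
      by (metis (no_types, lifting) rangeE)
  qed
  then obtain c where c: "\<And>k. k \<le> n \<Longrightarrow> (\<Sum>b\<in>K \<union> R. (\<lambda>i. c k b * b i)) = e k"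
    by metis
  \<comment> \<open>Column \<open>k\<close> of \<open>Q\<close> holds the coordinates of the unit
    vector \<open>e k\<close> in the basis \<open>P\<close>.\<close>
  define Q where "Q i k = c k (P i)" for i k
  have PQ: "(\<Sum>i = 0..n. P i k * Q i k') = e k' k" if "k' \<le> n" for k k'
    using fun_cong[OF c[OF that], of k]
    by (simp add: sum_apply Q_def mult.commute sum.reindex_bij_betw[OF bij, symmetric])
  have QP: "(\<Sum>k = 0..n. Q i k * P i' k) = (if i = i' then 1 else 0)" if "i \<le> n" "i' \<le> n" for i i'
  proof -
    \<comment> \<open>The other inverse relation follows from independence: \<open>q\<close> is the
      difference of two coordinate vectors of \<open>P i'\<close>, so it gives a vanishing
      combination of the basis.\<close>
    define q where "q j = (\<Sum>k = 0..n. Q j k * P i' k) - (if j = i' then 1 else 0)" for j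
    have "(\<Sum>j = 0..n. q j * P j m) = 0" for m
    proof -
      have "(\<Sum>j = 0..n. (\<Sum>k = 0..n. Q j k * P i' k) * P j m) =
          (\<Sum>k = 0..n. P i' k * (\<Sum>j = 0..n. P j m * Q j k))"
        by (simp add: sum_distrib_left sum_distrib_right ac_simps) (rule sum.swap)
      also have "\<dots> = (\<Sum>k = 0..n. P i' k * e k m)"
        by (simp add: PQ)
      also have "\<dots> = P i' m"
        using fun_cong[OF expand[OF PV[OF that(2)]], of m] by (simp add: sum_apply)
      finally have "(\<Sum>j = 0..n. (\<Sum>k = 0..n. Q j k * P i' k) * P j m) = P i' m" .
      moreover have "q j * P j m =
          (\<Sum>k = 0..n. Q j k * P i' k) * P j m - (if j = i' then P j m else 0)" for j
        by (simp add: q_def left_diff_distrib)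
      ultimately show ?thesis
        using that(2) by (simp add: sum_subtractf)
    qed
    then have "(\<Sum>b\<in>K \<union> R. (\<lambda>m. q (inv_into {0..n} P b) * b m)) = 0"
      using bij by (auto simp: fun_eq_iff sum_apply sum.reindex_bij_betw[OF bij, symmetric]
          bij_betw_inv_into_left)
    moreover have "P i \<in> K \<union> R"
      using bij that(1) by (auto simp: bij_betw_def)
    ultimately have "q (inv_into {0..n} P (P i)) = 0"
      by (rule cfun.independentD[OF KR(5) fin order.refl])
    then show ?thesis
      using bij that(1) by (simp add: bij_betw_inv_into_left q_def)
  qed
  show thesis
  proof (rule that[where P = P and Q = Q and l = l])
    show "l < n"
      using len unfolding l_def length_append by linarith
    show "\<forall>i\<le>l. P i \<in> V \<and> T (P i) = 0"
    proof (intro allI impI)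
      fix i
      assume "i \<le> l"
      then have "i < length xs"
        using len(2) unfolding l_def by linarith
      then have "P i \<in> K"
        using xs(1) by (auto simp: P_def nth_append)
      then show "P i \<in> V \<and> T (P i) = 0"
        using KR(1,2) by auto
    qed
    show "\<forall>i. l < i \<and> i \<le> n \<longrightarrow> P i \<in> T ` V"
    proof (intro allI impI)
      fix i
      assume "l < i \<and> i \<le> n"
      then have "length xs \<le> i" "i - length xs < length ys"
        using len unfolding l_def length_append by linarith+
      then have "P i \<in> R"
        using ys(1) by (auto simp: P_def nth_append)
      then show "P i \<in> T ` V"
        using KR(3) by auto
    qed
  qed (use PQ QP in \<open>auto simp: e_def\<close>)
qed

text \<open>A complex square matrix of positive size has an eigenvalue. This is applied to
  \<open>M\<close>, the transpose of \<open>N\<close>, to agree with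
  \<open>mat_apply\<close>.\<close>

lemma eigenvector_exists:
  fixes N :: "nat \<Rightarrow> nat \<Rightarrow> complex" and n :: nat
  obtains z u where "u \<noteq> (\<lambda>_. 0)" "\<forall>i>n. u i = 0"
    "\<forall>j\<le>n. (\<Sum>i = 0..n. N i j * u i) = z * (u j :: complex)"
proof -
  define M where "M = mat (Suc n) (Suc n) (\<lambda>(j, i). N i j)"
  have M: "M \<in> carrier_mat (Suc n) (Suc n)"
    by (simp add: M_def)
  obtain z where "eigenvalue M z"
    using spectrum_non_empty[OF M] by (auto simp: spectrum_def)
  then obtain w where w: "w \<in> carrier_vec (Suc n)" "w \<noteq> 0\<^sub>v (Suc n)" "M *\<^sub>v w = z \<cdot>\<^sub>v w"
    using M by (auto simp: eigenvalue_def eigenvector_def)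
  define u where "u i = (if i \<le> n then w $ i else 0)" for i
  show thesis
  proof (rule that)
    show "u \<noteq> (\<lambda>_. 0)"
      using w(1,2) by (auto simp: u_def fun_eq_iff vec_eq_iff less_Suc_eq_le)
    show "\<forall>i>n. u i = 0"
      by (simp add: u_def)
    show "\<forall>j\<le>n. (\<Sum>i = 0..n. N i j * u i) = z * u j"
    proof (intro allI impI)
      fix j
      assume "j \<le> n"
      have "(M *\<^sub>v w) $ j = (z \<cdot>\<^sub>v w) $ j"
        by (simp add: w(3))
      then have "(\<Sum>i = 0..<Suc n. N i j * w $ i) = z * w $ j"
        using \<open>j \<le> n\<close> w(1) by (simp add: M_def scalar_prod_def del: sum.op_ivl_Suc)
      then show "(\<Sum>i = 0..n. N i j * u i) = z * u j"
        using \<open>j \<le> n\<close> by (simp add: u_def atLeastLessThanSuc_atLeastAtMost)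
    qed
  qed
qed

section \<open>Jacobian ideals and splittings\<close>

text \<open>The combinations of the \<open>p j\<close> form an ideal containing each
  \<open>p j\<close>, and the generated ideal is the smallest such ideal.\<close>

lemma genideal_poly_ring_subset:
  assumes p: "\<And>j. j \<le> n \<Longrightarrow> p j \<in> polys {0..n}"
  shows "genideal (poly_ring n) (p ` {0..n}) \<subseteq>
    {\<Sum>j = 0..n. r j * p j | r. \<forall>j. r j \<in> polys {0..n}}" (is "_ \<subseteq> ?I")
proof -
  interpret cring "poly_ring n"
    by (rule cring_poly_ring)
  have carr: "carrier (poly_ring n) = polys {0..n}"
    by (simp add: poly_ring_def)
  have IC: "?I \<subseteq> carrier (poly_ring n)"
    unfolding carr using p by (auto intro!: polys_sum polys_mult)
  have mult: "q * x \<in> ?I" if "x \<in> ?I" "q \<in> polys {0..n}" for x q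
  proof -
    obtain r where "x = (\<Sum>j = 0..n. r j * p j)" "\<forall>j. r j \<in> polys {0..n}"
      using \<open>x \<in> ?I\<close> by blast
    then show ?thesis
      using that(2) by (auto simp: sum_distrib_left mult.assoc[symmetric] polys_mult
          intro!: exI[of _ "\<lambda>j. q * r j"])
  qed
  have add: "x + y \<in> ?I" if "x \<in> ?I" "y \<in> ?I" for x y
  proof -
    obtain r where "x = (\<Sum>j = 0..n. r j * p j)" "\<forall>j. r j \<in> polys {0..n}"
      using \<open>x \<in> ?I\<close> by blast
    moreover obtain s where "y = (\<Sum>j = 0..n. s j * p j)" "\<forall>j. s j \<in> polys {0..n}"
      using \<open>y \<in> ?I\<close> by blast
    ultimately show ?thesis
      by (auto simp: sum.distrib[symmetric] distrib_right[symmetric] polys_add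
          intro!: exI[of _ "\<lambda>j. r j + s j"])
  qed
  have zero: "0 \<in> ?I"
    by (auto simp: polys_0 intro!: exI[of _ "\<lambda>j. 0"])
  have "ideal ?I (poly_ring n)"
  proof (rule idealI)
    show "subgroup ?I (add_monoid (poly_ring n))"
    proof (rule group.subgroupI)
      show "group (add_monoid (poly_ring n))"
        by (rule a_group)
      show "?I \<subseteq> carrier (add_monoid (poly_ring n))"
        using IC by simp
      show "?I \<noteq> {}"
        using zero by blast
      show "x \<otimes>\<^bsub>add_monoid (poly_ring n)\<^esub> y \<in> ?I" if "x \<in> ?I" "y \<in> ?I" for x y
        using add[OF that] by (simp add: poly_ring_def)
      show "inv\<^bsub>add_monoid (poly_ring n)\<^esub> x \<in> ?I" if "x \<in> ?I" for x
      proof -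
        have "x \<in> polys {0..n}"
          using that IC carr by blast
        then have "\<ominus>\<^bsub>poly_ring n\<^esub> x = - x"
          by (intro minus_equality) (auto simp: poly_ring_def polys_uminus)
        moreover have "- 1 * x \<in> ?I"
          using that polys_uminus[OF polys_1] by (rule mult)
        ultimately show ?thesis
          by (simp add: a_inv_def)
      qed
    qed
  next
    fix x q
    assume x: "x \<in> ?I" and q: "q \<in> carrier (poly_ring n)"
    show "q \<otimes>\<^bsub>poly_ring n\<^esub> x \<in> ?I"
      using mult[OF x] q by (simp add: poly_ring_def)
    then show "x \<otimes>\<^bsub>poly_ring n\<^esub> q \<in> ?I"
      by (simp add: poly_ring_def mult.commute)
  qed (rule ring_axioms)
  moreover have "p ` {0..n} \<subseteq> ?I"
  proof
    fix x
    assume "x \<in> p ` {0..n}"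
    then obtain i where i: "i \<le> n" "x = p i"
      by auto
    have "(\<Sum>j = 0..n. (if j = i then 1 else 0) * p j) = (\<Sum>j = 0..n. if j = i then p j else 0)"
      by (rule sum.cong) auto
    then have "x = (\<Sum>j = 0..n. (if j = i then 1 else 0) * p j)"
      using i by simp
    moreover have "\<forall>j. (if j = i then 1 else 0) \<in> polys {0..n}"
      by (simp add: polys_0 polys_1)
    ultimately show "x \<in> ?I"
      by (intro CollectI exI[of _ "\<lambda>j. if j = i then 1 else 0"]) blast
  qed
  ultimately show ?thesis
    by (rule genideal_minimal)
qed

text \<open>A nonconstant term of \<open>r\<close> moves \<open>q\<close> into degrees above that of
  \<open>m\<close>, so only the constant term of \<open>r\<close> contributes.\<close>

lemma lookup_mult_form:
  assumes "form (mdeg m) q"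
  shows "Poly_Mapping.lookup (r * q) m = Poly_Mapping.lookup r 0 * Poly_Mapping.lookup q m"
proof (induction r rule: cpoly_induct_single)
  case (single a c)
  show ?case
  proof (cases "a = 0")
    case True
    then show ?thesis
      using lookup_const_poly_mult[of c q m] by (simp add: const_poly_def)
  next
    case False
    then have "mdeg a \<noteq> 0"
      by (simp add: mdeg_eq_0_iff)
    have "m \<notin> Poly_Mapping.keys (Poly_Mapping.single a c * q)"
    proof
      assume "m \<in> Poly_Mapping.keys (Poly_Mapping.single a c * q)"
      then obtain b where "m = a + b" "b \<in> Poly_Mapping.keys q"
        using Poly_Mapping.keys_mult[of "Poly_Mapping.single a c" q] by (auto split: if_splits)
      then show False
        using assms \<open>mdeg a \<noteq> 0\<close> by (auto simp: form_def mdeg_add)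
    qed
    then show ?thesis
      using False by (simp add: in_keys_iff lookup_single)
  qed
qed (simp add: lookup_add distrib_right)

lemma form_combination_const:
  assumes "\<And>j. j \<le> n \<Longrightarrow> form e (p j)" "form e (\<Sum>j = 0..n. r j * p j)"
  shows "(\<Sum>j = 0..n. r j * p j) = (\<Sum>j = 0..n. const_poly (Poly_Mapping.lookup (r j) 0) * p j)"
    (is "?l = ?r")
proof (rule poly_mapping_eqI)
  fix m
  have "form e ?r"
    using assms(1) by (intro form_sum form_const_mult) simp
  show "Poly_Mapping.lookup ?l m = Poly_Mapping.lookup ?r m"
  proof (cases "mdeg m = e")
    case True
    then show ?thesis
      using assms(1) by (simp add: lookup_sum lookup_mult_form)
  next
    case False
    then have "m \<notin> Poly_Mapping.keys ?l" "m \<notin> Poly_Mapping.keys ?r"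
      using assms(2) \<open>form e ?r\<close> by (auto simp: form_def)
    then show ?thesis
      by (simp add: in_keys_iff)
  qed
qed

text \<open>All partial derivatives of \<open>f\<close> and \<open>g\<close> are forms of degree
  \<open>d - 1\<close>, so the polynomial coefficients given by ideal membership may be replaced by
  their constant terms.\<close>

lemma jacobian_ideal_eq_imp_linear:
  assumes f: "f \<in> polys {0..n}" "form d f" and g: "g \<in> polys {0..n}" "form d g"
    and J: "jacobian_ideal n g \<subseteq> jacobian_ideal n f"
  obtains A where "\<forall>i\<le>n. partial_deriv i g = (\<Sum>j = 0..n. const_poly (A i j) * partial_deriv j f)"
proof -
  have "\<exists>a. partial_deriv i g = (\<Sum>j = 0..n. const_poly (a j) * partial_deriv j f)" if "i \<le> n" for i
  proof -
    interpret cring "poly_ring n"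
      by (rule cring_poly_ring)
    have "(\<lambda>i. partial_deriv i g) ` {0..n} \<subseteq> carrier (poly_ring n)"
      using g(1) by (auto simp: poly_ring_def polys_partial_deriv)
    then have "partial_deriv i g \<in> jacobian_ideal n g"
      unfolding jacobian_ideal_def using that by (intro subsetD[OF genideal_self]) auto
    also note J
    also have "jacobian_ideal n f \<subseteq> {\<Sum>j = 0..n. r j * partial_deriv j f | r. \<forall>j. r j \<in> polys {0..n}}"
      unfolding jacobian_ideal_def by (rule genideal_poly_ring_subset) (rule polys_partial_deriv[OF f(1)])
    finally obtain r where "partial_deriv i g = (\<Sum>j = 0..n. r j * partial_deriv j f)"
      by blast
    moreover from this have "form (d - 1) (\<Sum>j = 0..n. r j * partial_deriv j f)"
      using form_partial_deriv[OF g(2), of i] by simp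
    then have "(\<Sum>j = 0..n. r j * partial_deriv j f) =
        (\<Sum>j = 0..n. const_poly (Poly_Mapping.lookup (r j) 0) * partial_deriv j f)"
      by (rule form_combination_const[OF form_partial_deriv[OF f(2)]])
    ultimately show ?thesis
      by (intro exI[of _ "\<lambda>j. Poly_Mapping.lookup (r j) 0"]) (rule trans)
  qed
  then show thesis
    using that by metis
qed

text \<open>A matrix acting on gradients acts on directions through its transpose.\<close>

lemma dir_deriv_mat_apply:
  assumes "\<And>i. i \<le> n \<Longrightarrow> partial_deriv i g = (\<Sum>j = 0..n. const_poly (N i j) * partial_deriv j f)"
  shows "dir_deriv n (mat_apply n N u) f = dir_deriv n u g"
proof -
  have "dir_deriv n (mat_apply n N u) f =
      (\<Sum>j = 0..n. \<Sum>i = 0..n. const_poly (N i j) * const_poly (u i) * partial_deriv j f)"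
    by (simp add: dir_deriv_def mat_apply_def const_poly_sum const_poly_mult sum_distrib_right)
  also have "\<dots> = (\<Sum>i = 0..n. \<Sum>j = 0..n. const_poly (N i j) * const_poly (u i) * partial_deriv j f)"
    by (rule sum.swap)
  also have "\<dots> = dir_deriv n u g"
    unfolding dir_deriv_def by (intro sum.cong refl) (simp add: assms sum_distrib_left ac_simps)
  finally show ?thesis .
qed

lemma dir_deriv_zero_vector: "dir_deriv n 0 p = 0"
  by (simp add: dir_deriv_def)

section \<open>Splitting a form in adapted coordinates\<close>

lemma poly_mapping_split:
  fixes p :: "'a \<Rightarrow>\<^sub>0 'b::ab_group_add"
  obtains q r where "p = q + r" "Poly_Mapping.keys q = Poly_Mapping.keys p \<inter> S"
    "Poly_Mapping.keys r = Poly_Mapping.keys p - S"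
proof -
  define q where "q = (\<Sum>m \<in> Poly_Mapping.keys p \<inter> S. Poly_Mapping.single m (Poly_Mapping.lookup p m))"
  have "Poly_Mapping.lookup q m = (if m \<in> S then Poly_Mapping.lookup p m else 0)" for m
    unfolding q_def by (simp add: lookup_sum lookup_single when_def in_keys_iff)
  then show thesis
    by (intro that[of q "p - q"]) (auto simp: in_keys_iff lookup_minus split: if_splits)
qed

text \<open>A monomial involving both some \<open>x_i\<close> with \<open>i \<le> l\<close> and some
  \<open>x_j\<close> with \<open>j > l\<close> would survive in the mixed derivative, since its
  exponents are nonzero in characteristic zero. So each monomial belongs to one block.\<close>

lemma split_of_mixed_derivs_zero:
  assumes F: "F \<in> polys {0..n}" "form d F" "d > 0"
    and mixed: "\<And>i j. i \<le> l \<Longrightarrow> l < j \<Longrightarrow> j \<le> n \<Longrightarrow> partial_deriv i (partial_deriv j F) = 0"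
  obtains g h where "F = g + h" "g \<in> polys {0..l}" "form d g" "h \<in> polys {l+1..n}" "form d h"
proof -
  obtain g h where gh: "F = g + h"
      "Poly_Mapping.keys g = Poly_Mapping.keys F \<inter> {m. Poly_Mapping.keys m \<subseteq> {0..l}}"
      "Poly_Mapping.keys h = Poly_Mapping.keys F - {m. Poly_Mapping.keys m \<subseteq> {0..l}}"
    using poly_mapping_split .
  have "Poly_Mapping.keys m \<subseteq> {l+1..n}" if m: "m \<in> Poly_Mapping.keys h" for m
  proof
    fix i
    assume i: "i \<in> Poly_Mapping.keys m"
    have mF: "m \<in> Poly_Mapping.keys F" "Poly_Mapping.keys m \<subseteq> {0..n}"
      using m gh(3) F(1) by (auto simp: polys_def)
    have "\<not> Poly_Mapping.keys m \<subseteq> {0..l}"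
      using m gh(3) by simp
    then obtain j where j: "j \<in> Poly_Mapping.keys m" "l < j"
      by (metis atLeast0AtMost atMost_iff not_le subsetI)
    show "i \<in> {l+1..n}"
    proof (rule ccontr)
      assume "i \<notin> {l+1..n}"
      then have il: "i \<le> l"
        using i mF(2) by auto
      \<comment> \<open>This is \<open>m\<close> divided by \<open>x_i x_j\<close>, exactly, since
        both variables occur in \<open>m\<close> and \<open>i < j\<close>.\<close>
      let ?m = "m - Poly_Mapping.single i 1 - Poly_Mapping.single j 1"
      have "?m + Poly_Mapping.single i 1 + Poly_Mapping.single j 1 = m"
        using i j il
        by (auto intro!: poly_mapping_eqI simp: lookup_add lookup_minus lookup_single when_def in_keys_iff)
      then have "Poly_Mapping.lookup (partial_deriv i (partial_deriv j F)) ?m \<noteq> 0"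
        using mF(1) by (simp add: lookup_partial_deriv in_keys_iff lookup_add del: of_nat_Suc)
      then show False
        using mixed[OF il j(2)] j(1) mF(2) by auto
    qed
  qed
  then show thesis
    using gh F(2) by (intro that[of g h]) (auto simp: polys_def form_def)
qed

lemma ST_type_of_splitting:
  assumes f: "f \<in> polys {0..n}" "form d f" "d > 0" and l: "l < n"
    and supp: "\<And>i k. i \<le> n \<Longrightarrow> k > n \<Longrightarrow> P i k = 0"
    and PQ: "\<And>k k'. k \<le> n \<Longrightarrow> k' \<le> n \<Longrightarrow> (\<Sum>i = 0..n. P i k * Q i k') = (if k = k' then 1 else 0)"
    and QP: "\<And>i i'. i \<le> n \<Longrightarrow> i' \<le> n \<Longrightarrow> (\<Sum>k = 0..n. Q i k * P i' k) = (if i = i' then 1 else 0)"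
    and mixed: "\<And>i j. i \<le> l \<Longrightarrow> l < j \<Longrightarrow> j \<le> n \<Longrightarrow> dir_deriv n (P i) (dir_deriv n (P j) f) = 0"
  shows "ST_type n d f"
proof -
  \<comment> \<open>\<open>F\<close> is \<open>f\<close> written in the basis \<open>P\<close>, and
    the \<open>L i\<close> are the dual coordinate forms. By the chain rule the derivative of
    \<open>F\<close> by \<open>x_i\<close> corresponds to that of \<open>f\<close> along
    \<open>P i\<close>, so the hypothesis concerns the mixed derivatives of
    \<open>F\<close>.\<close>
  define M where "M k = (\<Sum>i = 0..n. const_poly (P i k) * var i)" for k
  define L where "L i = (\<Sum>k = 0..n. const_poly (Q i k) * var k)" for i
  define F where "F = subst_poly M f"
  have "M k = 0" if "k > n" for k
    using that supp by (simp add: M_def)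
  moreover have "partial_deriv i (M k) = const_poly (P i k)" if "i \<le> n" for i k
    using that by (simp add: M_def partial_deriv_sum partial_deriv_const_mult partial_deriv_var
        if_distrib cong: if_cong)
  ultimately have deriv: "partial_deriv i (subst_poly M p) = subst_poly M (dir_deriv n (P i) p)"
    if "i \<le> n" for i p
    using that by (intro partial_deriv_subst_poly) auto
  have "F \<in> polys {0..n}"
    unfolding F_def M_def by (intro polys_subst_poly polys_sum polys_mult polys_const polys_var)
  moreover have "form d F"
    unfolding F_def M_def by (intro form_subst_poly f form_sum form_const_mult form_var)
  ultimately obtain g h where gh: "F = g + h" "g \<in> polys {0..l}" "form d g" "h \<in> polys {l+1..n}" "form d h"
    by (rule split_of_mixed_derivs_zero[OF _ _ f(3), of F n l]) (use l in \<open>simp add: F_def deriv mixed\<close>)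
  have LM: "subst_poly L (M k) = var k" if "k \<le> n" for k
  proof -
    have "subst_poly L (M k) = (\<Sum>i = 0..n. \<Sum>j = 0..n. const_poly (P i k * Q i j) * var j)"
      by (simp add: M_def L_def subst_poly_sum subst_poly_mult const_poly_mult sum_distrib_left mult.assoc)
    also have "\<dots> = (\<Sum>j = 0..n. const_poly (\<Sum>i = 0..n. P i k * Q i j) * var j)"
      by (subst sum.swap) (simp add: const_poly_sum sum_distrib_right)
    also have "\<dots> = (\<Sum>j = 0..n. if k = j then var j else 0)"
      using that by (intro sum.cong) (auto simp: PQ)
    finally show ?thesis
      using that by simp
  qed
  have "f = subst_poly L F"
    unfolding F_def subst_poly_subst
    by (subst subst_poly_cong[OF f(1), of _ var]) (auto simp: LM subst_poly_var_id)
  then have "f = subst_poly L g + subst_poly L h"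
    by (simp add: gh(1) subst_poly_add)
  moreover have "linear_coordinates n L"
  proof -
    have ind: "\<forall>i\<in>{0..n}. c i = 0" if c: "(\<Sum>i = 0..n. const_poly (c i) * L i) = 0" for c
    proof -
      \<comment> \<open>Differentiating the relation by \<open>x_k\<close> extracts its coefficient;
        the inverse matrix \<open>P\<close> then isolates each \<open>c i'\<close>.\<close>
      have *: "(\<Sum>i = 0..n. c i * Q i k) = 0" if "k \<le> n" for k
      proof -
        have "partial_deriv k (\<Sum>i = 0..n. const_poly (c i) * L i) = const_poly (\<Sum>i = 0..n. c i * Q i k)"
          using that by (simp add: L_def partial_deriv_sum partial_deriv_const_mult partial_deriv_var
              const_poly_sum const_poly_mult if_distrib cong: if_cong)
        then show ?thesis
          using c by (metis const_poly_0 const_poly_eq_iff partial_deriv_0)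
      qed
      have "c i' = 0" if "i' \<le> n" for i'
      proof -
        have "0 = (\<Sum>k = 0..n. (\<Sum>i = 0..n. c i * Q i k) * P i' k)"
          by (simp add: *)
        also have "\<dots> = (\<Sum>i = 0..n. c i * (\<Sum>k = 0..n. Q i k * P i' k))"
          by (simp add: sum_distrib_left sum_distrib_right mult.assoc) (rule sum.swap)
        also have "\<dots> = (\<Sum>i = 0..n. if i = i' then c i else 0)"
          using that by (intro sum.cong) (auto simp: QP)
        finally show ?thesis
          using that by simp
      qed
      then show ?thesis
        by simp
    qed
    have "L i \<noteq> 0" if "i \<le> n" for i
    proof
      assume "L i = 0"
      then have "(\<Sum>j = 0..n. const_poly (if j = i then 1 else 0) * L j) = 0"
        by (intro sum.neutral) auto
      from ind[OF this] show False
        using that by (auto dest!: bspec[of _ _ i])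
    qed
    moreover have "L i \<in> polys {0..n}" for i
      unfolding L_def by (intro polys_sum polys_mult polys_const polys_var)
    moreover have "form 1 (L i)" for i
      unfolding L_def by (intro form_sum form_const_mult form_var)
    ultimately show ?thesis
      using ind by (auto simp: linear_coordinates_def homogeneous_def form_def)
  qed
  ultimately show ?thesis
    unfolding ST_type_def using gh l
    by (intro exI[of _ L] exI[of _ l] exI[of _ g] exI[of _ h]) (auto simp: homogeneous_def form_def)
qed

section \<open>The splitting attached to an eigenvalue\<close>

theorem corollary1p3:
  fixes n d :: nat and f g :: cpoly
  assumes "n \<ge> 1" and "d \<ge> 3"
    and "f \<in> polys {0..n}" and "homogeneous d f"
    and "g \<in> polys {0..n}" and "homogeneous d g"
    and "jacobian_ideal n f = jacobian_ideal n g"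
    and "f \<notin> {const_poly c * g | c. c \<noteq> 0}"
    and "smooth_hypersurface n f"
  shows "ST_type n d f"
proof -
  have ff: "form d f" and gf: "form d g" and g0: "g \<noteq> 0"
    using assms(4,6) by (auto simp: homogeneous_def form_def)
  obtain A where A: "\<forall>i\<le>n. partial_deriv i g = (\<Sum>j = 0..n. const_poly (A i j) * partial_deriv j f)"
    by (rule jacobian_ideal_eq_imp_linear[OF assms(3) ff assms(5) gf equalityD2[OF assms(7)]])
  obtain z u where u: "u \<noteq> (\<lambda>_. 0)" "\<forall>i>n. u i = 0"
    "\<forall>j\<le>n. (\<Sum>i = 0..n. A i j * u i) = z * u j"
    by (rule eigenvector_exists)
  define N where "N i j = A i j - (if i = j then z else 0)" for i j
  define G where "G = g - const_poly z * f"
  define V where "V = {v. \<forall>i>n. v i = (0::complex)}"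
  define T where "T = mat_apply n N"
  have G: "partial_deriv i G = (\<Sum>j = 0..n. const_poly (N i j) * partial_deriv j f)" if "i \<le> n" for i
  proof -
    have "const_poly (N i j) * partial_deriv j f =
        const_poly (A i j) * partial_deriv j f - (if i = j then const_poly z * partial_deriv j f else 0)" for j
      by (simp add: N_def const_poly_diff left_diff_distrib)
    then show ?thesis
      using that by (simp add: G_def partial_deriv_diff partial_deriv_const_mult A sum_subtractf)
  qed
  have DT: "dir_deriv n (T v) f = dir_deriv n v G" for v
    unfolding T_def by (rule dir_deriv_mat_apply) (rule G)
  have TV: "T v \<in> V" for v
    by (simp add: T_def V_def mat_apply_def)
  have mixed: "dir_deriv n v (dir_deriv n (T w) f) = 0" if "T v = 0" for v w
  proof -
    have "dir_deriv n v (dir_deriv n (T w) f) = dir_deriv n w (dir_deriv n (T v) f)"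
      unfolding DT by (rule dir_deriv_commute)
    then show ?thesis
      using that by (simp add: dir_deriv_zero_vector)
  qed
  \<comment> \<open>Here \<open>T v\<close> lies in kernel and range, so the second derivative of
    \<open>f\<close> along it vanishes and smoothness applies.\<close>
  have TT: "T v = 0" if "T (T v) = 0" for v
  proof
    fix i
    show "T v i = 0 i"
    proof (cases "i \<le> n")
      case True
      then show ?thesis
        using smooth_dir_deriv_twice_nonzero[OF assms(3) ff assms(2,9) mixed[OF that]] by simp
    next
      case False
      then show ?thesis
        using TV[of v] by (simp add: V_def)
    qed
  qed
  have Tu: "T u = 0"
    using u(2,3) by (auto simp: T_def mat_apply_def N_def fun_eq_iff left_diff_distrib sum_subtractf
        if_distrib[of "\<lambda>x. x * _"] cong: if_cong)
  have "\<exists>v\<in>V. T v \<noteq> 0"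
  proof (rule ccontr)
    assume *: "\<not> (\<exists>v\<in>V. T v \<noteq> 0)"
    have "partial_deriv i G = 0" if "i \<le> n" for i
    proof -
      \<comment> \<open>Along the unit vector \<open>e\<close> the directional derivative of
        \<open>G\<close> is its \<open>i\<close>-th partial derivative.\<close>
      define e where "e j = (if j = i then 1 else 0 :: complex)" for j
      have "e \<in> V"
        using that by (auto simp: V_def e_def)
      then have "T e = 0"
        using * by blast
      then have "dir_deriv n e G = 0"
        using DT[of e] by (simp add: dir_deriv_zero_vector)
      moreover have "dir_deriv n e G = (\<Sum>j = 0..n. if j = i then partial_deriv j G else 0)"
        unfolding dir_deriv_def by (rule sum.cong) (auto simp: e_def)
      ultimately show ?thesis
        using that by simp
    qed
    moreover have "G \<in> polys {0..n}"
      unfolding G_def by (intro polys_diff polys_mult polys_const assms)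
    moreover have "form d G"
      unfolding G_def by (intro form_diff form_const_mult ff gf)
    ultimately have *: "const_poly (of_nat d) * G = 0"
      using euler_identity[of G n d] by simp
    have "G = 0"
    proof (rule poly_mapping_eqI)
      fix m
      have "of_nat d * Poly_Mapping.lookup G m = 0"
        using arg_cong[OF *, of "\<lambda>p. Poly_Mapping.lookup p m"] by simp
      then show "Poly_Mapping.lookup G m = Poly_Mapping.lookup 0 m"
        using assms(2) by simp
    qed
    then have g: "g = const_poly z * f"
      by (simp add: G_def)
    \<comment> \<open>As \<open>g\<close> is nonzero, \<open>z\<close> is invertible, and
      \<open>f\<close> would be an excluded multiple of \<open>g\<close>.\<close>
    then have "z \<noteq> 0"
      using g0 by auto
    then have "f = const_poly (1 / z) * g"
      by (simp add: g mult.assoc[symmetric] const_poly_mult[symmetric])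
    then show False
      using assms(8) \<open>z \<noteq> 0\<close> by (auto dest: spec[of _ "1 / z"])
  qed
  then obtain v where v: "v \<in> V" "T v \<noteq> 0"
    by blast
  have uV: "u \<in> V" and u0: "u \<noteq> 0"
    using u(1,2) by (auto simp: V_def zero_fun_def)
  obtain P Q l where l: "l < n"
    and ker: "\<forall>i\<le>l. P i \<in> V \<and> T (P i) = 0"
    and ran: "\<forall>i. l < i \<and> i \<le> n \<longrightarrow> P i \<in> T ` V"
    and PQ: "\<forall>k\<le>n. \<forall>k'\<le>n. (\<Sum>i = 0..n. P i k * Q i k') = (if k = k' then 1 else 0)"
    and QP: "\<forall>i\<le>n. \<forall>i'\<le>n. (\<Sum>k = 0..n. Q i k * P i' k) = (if i = i' then 1 else 0)"
    by (rule kernel_range_coordinates[of n N u v, folded V_def T_def, OF TT uV u0 Tu v])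
  show ?thesis
  proof (rule ST_type_of_splitting[OF assms(3) ff _ l, of P Q])
    show "P i k = 0" if "i \<le> n" "k > n" for i k
    proof -
      have "P i \<in> V"
      proof (cases "i \<le> l")
        case False
        then have "P i \<in> T ` V"
          using ran that(1) by simp
        then show ?thesis
          using TV by auto
      qed (use ker in simp)
      then show ?thesis
        using that(2) by (simp add: V_def)
    qed
    show "dir_deriv n (P i) (dir_deriv n (P j) f) = 0" if ij: "i \<le> l" "l < j" "j \<le> n" for i j
    proof -
      obtain w where "P j = T w"
        using ran ij(2,3) by blast
      then show ?thesis
        using mixed ker ij(1) by simp
    qed
  qed (use assms(2) PQ QP in auto)
qed

end
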